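(* Let $W$ be an even positive integer with $W/2>d$. For every fixed finite sequence of virtual addresses to be translated, $$\mathrm{MIN}(W)\le \mathrm{ISMIN}(W)\le \mathrm{ISLRU}(W)\le \mathrm{LRU}(W)\le 2\,\mathrm{MIN}(W/2),$$ where, for a replacement strategy $A$ and a size $s>d$, $A(s)$ denotes the number of insertions performed by $A$ into an initially empty translation cache of size $s$ when serving the given sequence of translations.
   Context: Fix integers $K\ge 2$, $P\ge 1$, $d\ge 1$. The translation tree is the $K$-ary tree of height $d$ with nodes $(\ell,i)$, $0\le \ell\le d$, $0\le i<K^{d-\ell}$; $\ell$ is the layer of the node. A node $(\ell,i)$ with $\ell\ge1$ has the children $(\ell-1,Ki+a)$, $a=0,\dots,K-1$; the root is $(d,0)$; the leaves, on layer $0$, are the data pages. A virtual address is an integer $\alpha\in[0,K^dP-1]$; its translation path is $v_d,v_{d-1},\dots,v_0$ with $v_\ell=(\ell,\lfloor \alpha/(PK^\ell)\rfloor)$. A translation cache (TC) of size $W$ stores at most $W$ nodes of the tree; its content is changed by insertions and evictions of single nodes. Translating an address requires accessing all nodes of its translation path in the order $v_d,\dots,v_0$; a node can be accessed only while it is in the TC. A replacement strategy decides which nodes are inserted and evicted, and when, while serving a sequence of translations (it may depend on the whole sequence). A strategy is lazy if it inserts a missing node only when that node is accessed directly after the insertion, and evicts a node only immediately before an insertion for which there would otherwise be no free cell; otherwise it is eager. An initial segment of a rooted tree is the empty tree or a connected subgraph containing the root. A strategy has the initial segment property (ISP) if the TC content is an initial segment of the translation tree at all times. All four strategies below are lazy,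 so they are determined by which node they evict when an eviction is necessary. MIN: an optimal replacement strategy (fewest insertions), realized by always evicting a node whose next access is furthest in the future. LRU: evicts the least recently accessed node. ISLRU: evicts the lowest descendant in the TC (possibly the node itself) of the least recently accessed node. ISMIN: among the nodes in the TC that are not on the current translation path and have no descendants in the TC, evicts the one that is not used for the longest time into the future; nodes that will never be used again are evicted before the others, in arbitrary descendant-first order. *)

theory Defs
  imports Main "HOL-Library.Extended_Nat"
begin

type_synonym node = "nat \<times> nat"  \<comment> \<open>(layer, index)\<close>

definition tree_nodes :: "nat \<Rightarrow> nat \<Rightarrow> node set" where
  "tree_nodes K d = {(l, i). l \<le> d \<and> i < K ^ (d - l)}"

definition child :: "nat \<Rightarrow> nat \<Rightarrow> node \<Rightarrow> node \<Rightarrow> bool" where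
  "child K d v w \<longleftrightarrow> v \<in> tree_nodes K d \<and>
     (\<exists>l i a. v = (Suc l, i) \<and> a < K \<and> w = (l, K * i + a))"

text \<open>\<open>w\<close> is a descendant of \<open>v\<close>; every node is a descendant of itself.\<close>

definition descendant :: "nat \<Rightarrow> nat \<Rightarrow> node \<Rightarrow> node \<Rightarrow> bool" where
  "descendant K d v w \<longleftrightarrow> (child K d)\<^sup>*\<^sup>* v w"

definition translation_path :: "nat \<Rightarrow> nat \<Rightarrow> nat \<Rightarrow> nat \<Rightarrow> node list" where
  "translation_path K P d \<alpha> = map (\<lambda>l. (l, \<alpha> div (P * K ^ l))) (rev [0..<Suc d])"

text \<open>The node accesses for a sequence of addresses. Times are positions in this list; every
  translation contributes \<open>d + 1\<close> accesses, so access \<open>t\<close> belongs to translation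
  \<open>t div (d + 1)\<close>.\<close>

definition accesses :: "nat \<Rightarrow> nat \<Rightarrow> nat \<Rightarrow> nat list \<Rightarrow> node list" where
  "accesses K P d as = concat (map (translation_path K P d) as)"

definition current_path :: "nat \<Rightarrow> nat \<Rightarrow> nat \<Rightarrow> nat list \<Rightarrow> nat \<Rightarrow> node set" where
  "current_path K P d as t = set (translation_path K P d (as ! (t div Suc d)))"

text \<open>The time of the latest access before time \<open>t\<close>. It is meaningful only for nodes that have
  been accessed before, which under a lazy strategy includes all nodes in the cache.\<close>

definition last_access :: "nat \<Rightarrow> nat \<Rightarrow> nat \<Rightarrow> nat list \<Rightarrow> nat \<Rightarrow> node \<Rightarrow> nat" where
  "last_access K P d as t v = Max {i. i < t \<and> i < length (accesses K P d as) \<and> accesses K P d as ! i = v}"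

text \<open>The time of the next access from time \<open>t\<close> on, \<open>\<infinity>\<close> (the infimum of the empty set)
  if there is none.\<close>

definition next_access :: "nat \<Rightarrow> nat \<Rightarrow> nat \<Rightarrow> nat list \<Rightarrow> nat \<Rightarrow> node \<Rightarrow> enat" where
  "next_access K P d as t v =
     Inf (enat ` {i. t \<le> i \<and> i < length (accesses K P d as) \<and> accesses K P d as ! i = v})"

text \<open>A lazy strategy is determined by its evictions: given the address sequence, the time \<open>t\<close> of
  the access whose node is missing, and the content of the full cache, it names the node to
  evict.\<close>

type_synonym lazy_strategy = "nat list \<Rightarrow> nat \<Rightarrow> node set \<Rightarrow> node"

text \<open>The content of an initially empty cache of size \<open>s\<close> before access \<open>t\<close>.\<close>

primrec tc_content ::
  "nat \<Rightarrow> nat \<Rightarrow> nat \<Rightarrow> lazy_strategy \<Rightarrow> nat \<Rightarrow> nat list \<Rightarrow> nat \<Rightarrow> node set" where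
  "tc_content K P d A s as 0 = {}"
| "tc_content K P d A s as (Suc t) =
     (let C = tc_content K P d A s as t; v = accesses K P d as ! t in
      if v \<in> C then C
      else if card C < s then insert v C
      else insert v (C - {A as t C}))"

definition insertions ::
  "nat \<Rightarrow> nat \<Rightarrow> nat \<Rightarrow> lazy_strategy \<Rightarrow> nat \<Rightarrow> nat list \<Rightarrow> nat" where
  "insertions K P d A s as =
     card {t. t < length (accesses K P d as) \<and>
              accesses K P d as ! t \<notin> tc_content K P d A s as t}"

text \<open>The nodes each strategy may evict. The sets for MIN and ISMIN can have several elements,
  namely when several candidates are never accessed again; the choice among them is free.\<close>

definition min_victims :: "nat \<Rightarrow> nat \<Rightarrow> nat \<Rightarrow> nat list \<Rightarrow> nat \<Rightarrow> node set \<Rightarrow> node set" where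
  "min_victims K P d as t C =
     {v \<in> C. \<forall>w\<in>C. next_access K P d as t w \<le> next_access K P d as t v}"

definition lru_victims :: "nat \<Rightarrow> nat \<Rightarrow> nat \<Rightarrow> nat list \<Rightarrow> nat \<Rightarrow> node set \<Rightarrow> node set" where
  "lru_victims K P d as t C =
     {v \<in> C. \<forall>w\<in>C. last_access K P d as t v \<le> last_access K P d as t w}"

definition islru_victims :: "nat \<Rightarrow> nat \<Rightarrow> nat \<Rightarrow> nat list \<Rightarrow> nat \<Rightarrow> node set \<Rightarrow> node set" where
  "islru_victims K P d as t C =
     {w \<in> C. \<exists>v\<in>lru_victims K P d as t C. descendant K d v w \<and>
               (\<forall>u\<in>C. descendant K d v u \<longrightarrow> fst w \<le> fst u)}"

definition ismin_candidates :: "nat \<Rightarrow> nat \<Rightarrow> nat \<Rightarrow> nat list \<Rightarrow> nat \<Rightarrow> node set \<Rightarrow> node set" where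
  "ismin_candidates K P d as t C =
     {v \<in> C. v \<notin> current_path K P d as t \<and> (\<forall>w\<in>C. descendant K d v w \<longrightarrow> w = v)}"

definition ismin_victims :: "nat \<Rightarrow> nat \<Rightarrow> nat \<Rightarrow> nat list \<Rightarrow> nat \<Rightarrow> node set \<Rightarrow> node set" where
  "ismin_victims K P d as t C = min_victims K P d as t (ismin_candidates K P d as t C)"

text \<open>\<open>A\<close> always evicts a permitted node. Cache contents for which no node is permitted are
  exempted: a strategy is a total function, so it also has to return a node for contents that
  never arise, such as the empty cache.\<close>

definition evicts_from ::
  "lazy_strategy \<Rightarrow> (nat list \<Rightarrow> nat \<Rightarrow> node set \<Rightarrow> node set) \<Rightarrow> bool" where
  "evicts_from A V \<longleftrightarrow> (\<forall>as t C. V as t C \<noteq> {} \<longrightarrow> A as t C \<in> V as t C)"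

definition is_MIN :: "nat \<Rightarrow> nat \<Rightarrow> nat \<Rightarrow> lazy_strategy \<Rightarrow> bool" where
  "is_MIN K P d A \<longleftrightarrow> evicts_from A (min_victims K P d)"

definition is_LRU :: "nat \<Rightarrow> nat \<Rightarrow> nat \<Rightarrow> lazy_strategy \<Rightarrow> bool" where
  "is_LRU K P d A \<longleftrightarrow> evicts_from A (lru_victims K P d)"

definition is_ISLRU :: "nat \<Rightarrow> nat \<Rightarrow> nat \<Rightarrow> lazy_strategy \<Rightarrow> bool" where
  "is_ISLRU K P d A \<longleftrightarrow> evicts_from A (islru_victims K P d)"

definition is_ISMIN :: "nat \<Rightarrow> nat \<Rightarrow> nat \<Rightarrow> lazy_strategy \<Rightarrow> bool" where
  "is_ISMIN K P d A \<longleftrightarrow> evicts_from A (ismin_victims K P d)"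

lemma ex_evicts_from: "\<exists>A. evicts_from A V"
  unfolding evicts_from_def
  by (rule exI[of _ "\<lambda>as t C. SOME v. v \<in> V as t C"]) (auto intro: someI)

end

theory Submission
  imports Defs
begin

text \<open>MIN and ISMIN are compared with another cache by Belady's argument: for every future time
  \<open>\<theta>\<close>, the number of misses of the other cache plus the number of nodes in the optimal cache
  that are next used before \<open>\<theta>\<close> dominates the same sum with the roles exchanged. This survives
  restricting evictions to nodes off the current path, provided that the other cache keeps the
  already accessed part of the current path as well; this covers ISMIN against ISLRU.

  LRU holds the \<open>s\<close> most recently accessed nodes. The nodes in the cache that were last accessed in
  the oldest translation form a path, and ISLRU removes its lowest node. Hence ISLRU holds the top
  \<open>s\<close> nodes when they are ranked by the latest translation using them and, within a translation, from
  the root downwards. When a node is accessed, its ancestors have just been accessed, so that fewer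
  nodes are ranked above it than in LRU, and every hit of LRU is a hit of ISLRU.

  A period with \<open>W\<close> misses of LRU involves at least \<open>W\<close> distinct nodes, of which a cache
  of size \<open>W div 2\<close> misses at least half.\<close>

subsection \<open>Lazy caches\<close>

text \<open>Only times before \<open>N\<close> are constrained; past the end of the trace a strategy
  need not name a cached node. That the content never exceeds \<open>s\<close> is not assumed: it
  follows because a victim is always taken from the cache.\<close>

locale lazy_cache =
  fixes a :: "nat \<Rightarrow> 'a" and N s :: nat and evict :: "nat \<Rightarrow> 'a" and C :: "nat \<Rightarrow> 'a set"
  assumes s_pos: "s > 0"
    and content_0: "C 0 = {}"
    and content_hit: "\<lbrakk>t < N; a t \<in> C t\<rbrakk> \<Longrightarrow> C (Suc t) = C t"
    and content_free: "\<lbrakk>t < N; a t \<notin> C t; card (C t) < s\<rbrakk> \<Longrightarrow> C (Suc t) = insert (a t) (C t)"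
    and content_full: "\<lbrakk>t < N; a t \<notin> C t; card (C t) = s\<rbrakk> \<Longrightarrow>
      C (Suc t) = insert (a t) (C t - {evict t})"
    and evict_mem: "\<lbrakk>t < N; a t \<notin> C t; card (C t) = s\<rbrakk> \<Longrightarrow> evict t \<in> C t"
begin

definition misses :: "nat \<Rightarrow> nat" where
  "misses n = card {t. t < n \<and> a t \<notin> C t}"

lemma misses_0 [simp]: "misses 0 = 0"
  by (simp add: misses_def)

lemma misses_Suc: "misses (Suc n) = misses n + (if a n \<in> C n then 0 else 1)"
proof -
  have "{t. t < Suc n \<and> a t \<notin> C t}
    = (if a n \<in> C n then {t. t < n \<and> a t \<notin> C t} else insert n {t. t < n \<and> a t \<notin> C t})"
    by (auto simp: less_Suc_eq)
  then show ?thesis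
    by (simp add: misses_def)
qed

lemma misses_mono: "m \<le> n \<Longrightarrow> misses m \<le> misses n"
  unfolding misses_def by (rule card_mono) auto

lemma finite_card_content: "t \<le> N \<Longrightarrow> finite (C t) \<and> card (C t) \<le> s"
proof (induction t)
  case 0
  then show ?case by (simp add: content_0)
next
  case (Suc t)
  then have IH: "finite (C t)" "card (C t) \<le> s" and t: "t < N" by auto
  consider "a t \<in> C t" | "a t \<notin> C t" "card (C t) < s" | "a t \<notin> C t" "card (C t) = s"
    using IH by linarith
  then show ?case
  proof cases
    case 1
    then show ?thesis using IH content_hit[OF t] by simp
  next
    case 2
    then show ?thesis using IH content_free[OF t] by simp
  next
    case 3
    then show ?thesis
      using IH content_full[OF t] evict_mem[OF t] s_pos by (simp add: card_Diff_singleton)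
  qed
qed

lemma finite_content: "t \<le> N \<Longrightarrow> finite (C t)"
  and card_content: "t \<le> N \<Longrightarrow> card (C t) \<le> s"
  using finite_card_content by blast+

lemma content_cases:
  assumes "t < N"
  obtains (hit) "a t \<in> C t" "C (Suc t) = C t"
  | (free) "a t \<notin> C t" "card (C t) < s" "C (Suc t) = insert (a t) (C t)"
  | (full) "a t \<notin> C t" "card (C t) = s" "evict t \<in> C t"
      "C (Suc t) = insert (a t) (C t - {evict t})"
proof -
  have "card (C t) < s \<or> card (C t) = s"
    using card_content[of t] assms by linarith
  then show thesis
    using that content_hit[OF assms] content_free[OF assms] content_full[OF assms]
      evict_mem[OF assms] by blast
qed

lemma accessed_mem: "t < N \<Longrightarrow> a t \<in> C (Suc t)"
  by (erule content_cases) auto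

lemma content_Suc_subset: "t < N \<Longrightarrow> C (Suc t) \<subseteq> insert (a t) (C t)"
  by (erule content_cases) auto

lemma content_accessed: "t \<le> N \<Longrightarrow> C t \<subseteq> a ` {..<t}"
proof (induction t)
  case 0
  then show ?case by (simp add: content_0)
next
  case (Suc t)
  then show ?case using content_Suc_subset[of t] by (auto simp: lessThan_Suc)
qed

lemma content_interval: "\<lbrakk>m \<le> n; n \<le> N\<rbrakk> \<Longrightarrow> C n \<subseteq> C m \<union> a ` {m..<n}"
proof (induction n)
  case 0
  then show ?case by simp
next
  case (Suc n)
  then show ?case using content_Suc_subset[of n]
    by (cases "m = Suc n") (auto simp: atLeastLessThanSuc)
qed

text \<open>Elements enter the cache only when accessed, so the first access in the window to an
  element absent at time \<open>m\<close> is a miss. This is the lower bound used against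
  MIN.\<close>

lemma distinct_le_misses:
  assumes "m \<le> n" "n \<le> N"
  shows "card (a ` {m..<n} - C m) \<le> misses n - misses m"
proof -
  have "a ` {m..<n} - C m \<subseteq> a ` {t. m \<le> t \<and> t < n \<and> a t \<notin> C t}"
  proof
    fix v assume v: "v \<in> a ` {m..<n} - C m"
    let ?t = "LEAST t. m \<le> t \<and> a t = v"
    obtain u where u: "m \<le> u" "u < n" "a u = v" using v by auto
    have t: "m \<le> ?t \<and> a ?t = v" by (rule LeastI[of _ u]) (use u in simp)
    have "?t \<le> u" by (rule Least_le) (use u in simp)
    then have tn: "?t < n" using u by simp
    have "v \<notin> a ` {m..<?t}"
    proof
      assume "v \<in> a ` {m..<?t}"
      then obtain i where i: "m \<le> i" "i < ?t" "a i = v" by auto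
      show False using not_less_Least[OF i(2)] i by simp
    qed
    then have "v \<notin> C ?t"
      using content_interval[of m ?t] t tn assms v by auto
    then show "v \<in> a ` {t. m \<le> t \<and> t < n \<and> a t \<notin> C t}"
      using t tn by (intro image_eqI[of _ _ ?t]) auto
  qed
  then have "card (a ` {m..<n} - C m) \<le> card (a ` {t. m \<le> t \<and> t < n \<and> a t \<notin> C t})"
    by (intro card_mono) auto
  also have "\<dots> \<le> card {t. m \<le> t \<and> t < n \<and> a t \<notin> C t}"
    by (intro card_image_le) auto
  also have "{t. m \<le> t \<and> t < n \<and> a t \<notin> C t}
      = {t. t < n \<and> a t \<notin> C t} - {t. t < m \<and> a t \<notin> C t}"
    by auto
  also have "card \<dots> = misses n - misses m"
    unfolding misses_def using assms by (intro card_Diff_subset) auto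
  finally show ?thesis .
qed

end

subsection \<open>Optimality of evicting the furthest next use\<close>

definition next_use :: "(nat \<Rightarrow> 'a) \<Rightarrow> nat \<Rightarrow> nat \<Rightarrow> 'a \<Rightarrow> enat" where
  "next_use a N t v = Inf (enat ` {i. t \<le> i \<and> i < N \<and> a i = v})"

lemma next_use_le: "\<lbrakk>t \<le> i; i < N; a i = v\<rbrakk> \<Longrightarrow> next_use a N t v \<le> enat i"
  unfolding next_use_def by (rule Inf_lower) auto

lemma next_use_ge: "enat t \<le> next_use a N t v"
  unfolding next_use_def by (rule Inf_greatest) auto

lemma next_use_attained:
  assumes "next_use a N t v = enat i"
  shows "t \<le> i \<and> i < N \<and> a i = v"
proof -
  let ?S = "{i. t \<le> i \<and> i < N \<and> a i = v}"
  have "?S \<noteq> {}"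
    using assms unfolding next_use_def by (metis Inf_enat_def enat.distinct(2) image_empty)
  then have "Inf (enat ` ?S) \<in> enat ` ?S"
    unfolding Inf_enat_def by (auto intro: LeastI simp del: image_iff)
  then show ?thesis using assms unfolding next_use_def by auto
qed

lemma next_use_now: "t < N \<Longrightarrow> next_use a N t (a t) = enat t"
  by (simp add: antisym next_use_ge next_use_le)

lemma next_use_Suc:
  assumes "a t \<noteq> v"
  shows "next_use a N (Suc t) v = next_use a N t v"
proof -
  have "{i. Suc t \<le> i \<and> i < N \<and> a i = v} = {i. t \<le> i \<and> i < N \<and> a i = v}"
    using assms by (auto simp: Suc_le_eq le_less)
  then show ?thesis by (simp add: next_use_def)
qed

lemma next_use_end: "next_use a N N v = \<infinity>"
proof -
  have "{i. N \<le> i \<and> i < N \<and> a i = v} = {}" by auto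
  then show ?thesis unfolding next_use_def by (simp only: image_empty Inf_enat_def simp_thms if_True)
qed

text \<open>Since both caches contain \<open>Q t\<close>, the protected elements cancel in the comparison of the
  two counts that is kept invariant.\<close>

lemma furthest_next_optimal:
  fixes a :: "nat \<Rightarrow> 'a"
  assumes "lazy_cache a N s ev M" and "lazy_cache a N s ev' C"
    and QM: "\<And>t. t < N \<Longrightarrow> Q t \<subseteq> M t"
    and QC: "\<And>t. t < N \<Longrightarrow> Q t \<subseteq> C (Suc t)"
    and evQ: "\<And>t. \<lbrakk>t < N; a t \<notin> M t; card (M t) = s\<rbrakk> \<Longrightarrow> ev t \<notin> Q t"
    and furthest: "\<And>t v. \<lbrakk>t < N; a t \<notin> M t; card (M t) = s; v \<in> M t - Q t\<rbrakk> \<Longrightarrow>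
      next_use a N t v \<le> next_use a N t (ev t)"
  shows "lazy_cache.misses a M N \<le> lazy_cache.misses a C N"
proof -
  interpret M: lazy_cache a N s ev M by fact
  interpret C: lazy_cache a N s ev' C by fact
  define cnt where "cnt t S \<theta> = card {v \<in> S. next_use a N t v < \<theta>}" for t S \<theta>
  \<comment> \<open>Two thresholds are finally exploited: \<open>enat (Suc t)\<close> isolates the
    element accessed now, and \<open>\<infinity>\<close> yields the claim at time \<open>N\<close>.
    The others carry the induction.\<close>
  have inv: "\<forall>\<theta>>enat t. M.misses t + cnt t (C t) \<theta> \<le> C.misses t + cnt t (M t) \<theta>"
    if "t \<le> N" for t
    using that
  proof (induction t)
    case 0
    then show ?case by (simp add: M.content_0 C.content_0)
  next
    case (Suc t)
    then have t: "t < N"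
      and IH: "\<And>\<theta>. enat t < \<theta> \<Longrightarrow>
        M.misses t + cnt t (C t) \<theta> \<le> C.misses t + cnt t (M t) \<theta>" by auto
    define x where "x = a t"
    have fin: "finite (M t)" "finite (C t)" "finite (M (Suc t))" "finite (C (Suc t))"
      using t by (auto intro: M.finite_content C.finite_content)
    have now: "next_use a N t x = enat t" using next_use_now[OF t] by (simp add: x_def)
    have later: "next_use a N (Suc t) v = next_use a N t v" if "v \<noteq> x" for v
      using that next_use_Suc[of a t v N] by (simp add: x_def)
    have cnt_old: "cnt t S \<theta> = cnt t (S - {x}) \<theta> + (if x \<in> S then 1 else 0)"
      if "finite S" "enat t < \<theta>" for S \<theta>
    proof (cases "x \<in> S")
      case True
      then have "{v \<in> S. next_use a N t v < \<theta>} = insert x {v \<in> S - {x}. next_use a N t v < \<theta>}"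
        using that(2) now by auto
      then show ?thesis using that True by (simp add: cnt_def)
    qed simp
    have cnt_new: "cnt (Suc t) S \<theta>
        = cnt t (S - {x}) \<theta> + (if next_use a N (Suc t) x < \<theta> then 1 else 0)"
      if "finite S" "x \<in> S" for S \<theta>
    proof -
      have "cnt t (S - {x}) \<theta> = card {v \<in> S - {x}. next_use a N (Suc t) v < \<theta>}"
        unfolding cnt_def by (intro arg_cong[where f = card]) (auto simp: later)
      moreover have "{v \<in> S. next_use a N (Suc t) v < \<theta>}
        = (if next_use a N (Suc t) x < \<theta> then insert x {v \<in> S - {x}. next_use a N (Suc t) v < \<theta>}
           else {v \<in> S - {x}. next_use a N (Suc t) v < \<theta>})"
        using that(2) by auto
      ultimately show ?thesis using that by (simp add: cnt_def)
    qed
    have cnt_now: "cnt t (S - {x}) (enat (Suc t)) = 0" for S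
    proof -
      have "enat (Suc t) \<le> next_use a N t v" if "v \<noteq> x" for v
        using later[OF that] next_use_ge[of "Suc t" a N v] by simp
      then have "{v \<in> S - {x}. next_use a N t v < enat (Suc t)} = {}"
        by (auto simp: not_less)
      then show ?thesis unfolding cnt_def by (simp only: card.empty)
    qed
    have x_in: "x \<in> M (Suc t)" "x \<in> C (Suc t)"
      using t M.accessed_mem C.accessed_mem by (auto simp: x_def)
    have "C (Suc t) - {x} \<subseteq> C t - {x}"
      using C.content_Suc_subset[OF t] by (auto simp: x_def)
    then have C_le: "cnt t (C (Suc t) - {x}) \<theta> \<le> cnt t (C t - {x}) \<theta>" for \<theta>
      unfolding cnt_def using fin by (intro card_mono) auto
    \<comment> \<open>After the access \<open>x\<close> is in both caches and contributes equally to
      both new counts, so it can be left out.\<close>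
    have goal: "M.misses (Suc t) + cnt t (C (Suc t) - {x}) \<theta>
        \<le> C.misses (Suc t) + cnt t (M (Suc t) - {x}) \<theta>" if \<theta>: "enat (Suc t) < \<theta>" for \<theta>
    proof -
      have \<theta>': "enat t < \<theta>" using \<theta> by (meson enat_ord_simps(2) less_trans lessI)
      note old = IH[OF \<theta>', unfolded cnt_old[OF fin(1) \<theta>'] cnt_old[OF fin(2) \<theta>']]
      \<comment> \<open>Each cache either holds \<open>x\<close> or misses it, so taking
        \<open>x\<close> out of the old counts pays exactly for the new misses.\<close>
      have keep: ?thesis if "cnt t (M (Suc t) - {x}) \<theta> = cnt t (M t - {x}) \<theta>"
        using old C_le[of \<theta>] that
        by (auto simp: M.misses_Suc C.misses_Suc x_def split: if_splits)
      show ?thesis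
        using t
      proof (cases rule: M.content_cases)
        case hit
        then show ?thesis by (intro keep) simp
      next
        case free
        then show ?thesis by (intro keep) (simp add: x_def)
      next
        case full
        define y where "y = ev t"
        have M': "M (Suc t) - {x} = M t - {y}" using full by (auto simp: x_def y_def)
        have yM: "y \<in> M t" using full y_def by simp
        show ?thesis
        proof (cases "next_use a N t y < \<theta>")
          case False
          then have "{v \<in> M t - {y}. next_use a N t v < \<theta>}
              = {v \<in> M t - {x}. next_use a N t v < \<theta>}"
            using full by (auto simp: x_def)
          then show ?thesis by (intro keep) (simp add: M' cnt_def)
        next
          case True
          \<comment> \<open>The victim is the furthest unprotected element, so now all unprotected
            elements of \<open>M t\<close> are used before \<open>\<theta>\<close>. Outside
            \<open>?Q\<close>, every one of the \<open>s - 1\<close> places counts, and the other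
            cache cannot do better.\<close>
          let ?Q = "Q t"
          let ?near = "\<lambda>S. {v \<in> S. next_use a N t v < \<theta>}"
          have far: "next_use a N t v < \<theta>" if "v \<in> M t - ?Q" for v
            using furthest[OF t full(1,2) that] True by (simp add: y_def)
          have Q: "?Q \<subseteq> M t - {y}" "?Q \<subseteq> C (Suc t) - {x}"
            using QM[OF t] QC[OF t] evQ[OF t full(1,2)] full(1) by (auto simp: x_def y_def)
          have finQ: "finite ?Q" using Q(1) fin(1) finite_subset by blast
          have eqM: "?near (M t - {y}) = ?near ?Q \<union> ((M t - {y}) - ?Q)"
            using far Q by auto
          have "cnt t (M t - {y}) \<theta> = card (?near ?Q) + card ((M t - {y}) - ?Q)"
            unfolding cnt_def eqM by (intro card_Un_disjoint) (use finQ fin in auto)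
          also have "card ((M t - {y}) - ?Q) = s - 1 - card ?Q"
            using Q(1) finQ full(2) yM fin(1) by (simp add: card_Diff_subset)
          finally have m: "cnt t (M t - {y}) \<theta> = card (?near ?Q) + (s - 1 - card ?Q)" .
          have "cnt t (C (Suc t) - {x}) \<theta>
              \<le> card (?near ?Q \<union> ((C (Suc t) - {x}) - ?Q))"
            unfolding cnt_def using finQ fin by (intro card_mono) auto
          also have "\<dots> \<le> card (?near ?Q) + card ((C (Suc t) - {x}) - ?Q)"
            by (rule card_Un_le)
          also have "card ((C (Suc t) - {x}) - ?Q) = card (C (Suc t)) - 1 - card ?Q"
            using Q(2) finQ x_in fin(4) by (simp add: card_Diff_subset)
          also have "\<dots> \<le> s - 1 - card ?Q"
            using C.card_content[of "Suc t"] t by (intro diff_le_mono) auto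
          finally have "cnt t (C (Suc t) - {x}) \<theta> \<le> cnt t (M t - {y}) \<theta>"
            using m by simp
          \<comment> \<open>At threshold \<open>enat (Suc t)\<close> only \<open>x\<close> can
            count, and \<open>x\<close> is not in \<open>M t\<close>. The induction hypothesis thus
            leaves \<open>M\<close> strictly behind in misses if the other cache hits, which covers
            the present miss.\<close>
          moreover have "M.misses (Suc t) \<le> C.misses (Suc t)"
          proof -
            have now: "enat t < enat (Suc t)" by simp
            have "x \<notin> M t" using full(1) by (simp add: x_def)
            then have "M.misses t + (if x \<in> C t then 1 else 0) \<le> C.misses t"
              using IH[OF now]
              unfolding cnt_old[OF fin(1) now] cnt_old[OF fin(2) now] cnt_now
              by (simp only: if_False add_0 add_0_right)
            then show ?thesis
              using full(1) by (simp add: M.misses_Suc C.misses_Suc x_def split: if_splits)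
          qed
          ultimately show ?thesis by (simp add: M')
        qed
      qed
    qed
    show ?case
    proof (intro allI impI)
      fix \<theta> assume "enat (Suc t) < \<theta>"
      from goal[OF this] show "M.misses (Suc t) + cnt (Suc t) (C (Suc t)) \<theta>
          \<le> C.misses (Suc t) + cnt (Suc t) (M (Suc t)) \<theta>"
        unfolding cnt_new[OF fin(3) x_in(1)] cnt_new[OF fin(4) x_in(2)] by simp
    qed
  qed
  \<comment> \<open>Nothing is used from time \<open>N\<close> on, so both counts vanish and only
    the misses remain.\<close>
  have "cnt N S \<infinity> = 0" for S
    by (simp add: cnt_def next_use_end)
  then show ?thesis
    using inv[OF order_refl] by (metis add.right_neutral enat_ord_code(4))
qed

subsection \<open>Caches ordered by a key\<close>

text \<open>Evicting a smallest key keeps the \<open>s\<close> top-ranked elements, provided that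
  the forced insertion of \<open>a t\<close> respects the ranking: \<open>key_rise\<close> says that
  its new key is among the top \<open>s\<close>.\<close>

locale keyed_cache = lazy_cache +
  fixes key :: "nat \<Rightarrow> 'a \<Rightarrow> nat"
  assumes key_other: "\<lbrakk>t < N; w \<in> a ` {..<t}; w \<noteq> a t\<rbrakk> \<Longrightarrow> key (Suc t) w = key t w"
    and key_mono: "\<lbrakk>t < N; a t \<in> a ` {..<t}\<rbrakk> \<Longrightarrow> key t (a t) \<le> key (Suc t) (a t)"
    and key_rise: "t < N \<Longrightarrow>
      card {w \<in> a ` {..<t}. w \<noteq> a t \<and> key (Suc t) (a t) \<le> key t w} < s"
    and evict_min_key: "\<lbrakk>t < N; a t \<notin> C t; card (C t) = s; v \<in> C t\<rbrakk> \<Longrightarrow>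
      key t (evict t) \<le> key t v"
begin

lemma all_cached_or_full: "t \<le> N \<Longrightarrow> a ` {..<t} \<subseteq> C t \<or> card (C t) = s"
proof (induction t)
  case 0
  then show ?case by simp
next
  case (Suc t)
  then have t: "t < N" and IH: "a ` {..<t} \<subseteq> C t \<or> card (C t) = s" by auto
  show ?case
    using t
  proof (cases rule: content_cases)
    case hit
    then show ?thesis using IH by (auto simp: lessThan_Suc)
  next
    case free
    then show ?thesis using IH by (auto simp: lessThan_Suc)
  next
    case full
    then show ?thesis using finite_content[of t] t s_pos by simp
  qed
qed

text \<open>Evicting a smallest key preserves closure among the old elements, and a hit only raises
  the key of its element. The delicate case is a newly inserted element, which must not rank below
  something outside the cache.\<close>

lemma content_upward_closed:
  "\<lbrakk>t \<le> N; v \<in> C t; w \<in> a ` {..<t}; key t v < key t w\<rbrakk> \<Longrightarrow> w \<in> C t"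
proof (induction t arbitrary: v w)
  case 0
  then show ?case by simp
next
  case (Suc t)
  then have t: "t < N" by simp
  have sub: "C t \<subseteq> a ` {..<t}" using content_accessed t by simp
  have IH: "w \<in> C t" if "v \<in> C t" "w \<in> a ` {..<t}" "key t v < key t w" for v w
    using Suc.IH[of v w] t that by simp
  show ?case
  proof (cases "w = a t")
    case True
    then show ?thesis using accessed_mem t by simp
  next
    case False
    then have w: "w \<in> a ` {..<t}" using Suc.prems by (auto simp: lessThan_Suc)
    have kw: "key (Suc t) w = key t w" using key_other t w False by simp
    show ?thesis
      using t
    proof (cases rule: content_cases)
      case hit
      have "key t v \<le> key (Suc t) v"
      proof (cases "v = a t")
        case True
        then show ?thesis using key_mono[OF t] hit sub by auto
      next
        case False
        then show ?thesis using key_other[OF t, of v] hit sub Suc.prems(2) by auto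
      qed
      then show ?thesis using hit IH[of v w] Suc.prems kw w by simp
    next
      case free
      \<comment> \<open>With a free cell, everything accessed so far is still cached.\<close>
      then show ?thesis using all_cached_or_full[of t] t w by auto
    next
      case full
      let ?y = "evict t"
      have fin: "finite (C t)" using finite_content t by simp
      have y_low: "key t ?y < key t w"
      proof (cases "v = a t")
        case True
        \<comment> \<open>Otherwise all \<open>s\<close> cached elements would have keys at least as
          large as the new one, against \<open>key_rise\<close>.\<close>
        have "key t ?y < key (Suc t) (a t)"
        proof (rule ccontr)
          assume "\<not> ?thesis"
          then have "C t \<subseteq> {w \<in> a ` {..<t}. w \<noteq> a t \<and> key (Suc t) (a t) \<le> key t w}"
            using evict_min_key[OF t full(1,2)] sub full(1) by fastforce
          then have "card (C t) \<le> card {w \<in> a ` {..<t}. w \<noteq> a t \<and> key (Suc t) (a t) \<le> key t w}"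
            by (intro card_mono) auto
          then show False using key_rise[OF t] full(2) by simp
        qed
        then show ?thesis using Suc.prems True kw by simp
      next
        case False
        then have v: "v \<in> C t" using Suc.prems full by auto
        then have "key (Suc t) v = key t v" using key_other[OF t _ False] sub by auto
        then show ?thesis
          using evict_min_key[OF t full(1,2) v] Suc.prems kw by simp
      qed
      then have "w \<in> C t" using IH full w by blast
      then show ?thesis using full y_low by auto
    qed
  qed
qed

text \<open>By upward closure all elements ranked strictly above \<open>v\<close> share the cache
  with \<open>v\<close>.\<close>

lemma mem_content_rank:
  assumes "t \<le> N" "v \<in> C t"
  shows "card {w \<in> a ` {..<t}. key t v < key t w} < s"
proof -
  have "{w \<in> a ` {..<t}. key t v < key t w} \<subseteq> C t - {v}"
    using content_upward_closed assms by auto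
  then have "card {w \<in> a ` {..<t}. key t v < key t w} \<le> card (C t - {v})"
    using finite_content[OF assms(1)] by (intro card_mono) auto
  also have "\<dots> < card (C t)" using assms finite_content by (intro card_Diff1_less) auto
  finally show ?thesis using card_content[OF assms(1)] by simp
qed

text \<open>If an element accessed before is absent, the cache is full and by upward closure holds
  nothing ranked below it. Ties may be resolved either way, hence the weak inequality here against
  the strict one in \<open>mem_content_rank\<close>.\<close>

lemma not_mem_content_rank:
  assumes "t \<le> N" "v \<in> a ` {..<t}" "v \<notin> C t"
  shows "s \<le> card {w \<in> a ` {..<t}. w \<noteq> v \<and> key t v \<le> key t w}"
proof -
  have "C t \<subseteq> {w \<in> a ` {..<t}. w \<noteq> v \<and> key t v \<le> key t w}"
    using content_upward_closed[OF assms(1) _ assms(2)] content_accessed[OF assms(1)] assms(3)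
    by (auto simp: not_less[symmetric])
  then have "card (C t) \<le> card {w \<in> a ` {..<t}. w \<noteq> v \<and> key t v \<le> key t w}"
    by (intro card_mono) auto
  then show ?thesis using all_cached_or_full[OF assms(1)] assms by auto
qed

end

subsection \<open>Least recently used\<close>

definition last_use :: "(nat \<Rightarrow> 'a) \<Rightarrow> nat \<Rightarrow> 'a \<Rightarrow> nat" where
  "last_use a t v = Max {i. i < t \<and> a i = v}"

lemma last_use_mem:
  assumes "v \<in> a ` {..<t}"
  shows "last_use a t v < t \<and> a (last_use a t v) = v"
proof -
  have "last_use a t v \<in> {i. i < t \<and> a i = v}"
    unfolding last_use_def using assms by (intro Max_in) auto
  then show ?thesis by simp
qed

lemma last_use_ge: "\<lbrakk>i < t; a i = v\<rbrakk> \<Longrightarrow> i \<le> last_use a t v"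
  unfolding last_use_def by (intro Max_ge) auto

lemma last_use_now: "last_use a (Suc t) (a t) = t"
  using last_use_ge[of t "Suc t" a "a t"] last_use_mem[of "a t" a "Suc t"] by fastforce

lemma last_use_other:
  assumes "a t \<noteq> v"
  shows "last_use a (Suc t) v = last_use a t v"
proof -
  have "{i. i < Suc t \<and> a i = v} = {i. i < t \<and> a i = v}"
    using assms by (auto simp: less_Suc_eq)
  then show ?thesis by (simp add: last_use_def)
qed

locale lru_cache = lazy_cache +
  assumes evict_lru: "\<lbrakk>t < N; a t \<notin> C t; card (C t) = s; v \<in> C t\<rbrakk> \<Longrightarrow>
      last_use a t (evict t) \<le> last_use a t v"
begin

sublocale keyed_cache a N s evict C "last_use a"
proof
  fix t assume "t < N"
  have "{w \<in> a ` {..<t}. w \<noteq> a t \<and> last_use a (Suc t) (a t) \<le> last_use a t w} = {}"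
    using last_use_mem[of _ a t] by (auto simp: last_use_now not_le)
  then show "card {w \<in> a ` {..<t}. w \<noteq> a t \<and> last_use a (Suc t) (a t) \<le> last_use a t w} < s"
    using s_pos by (metis card.empty)
next
  fix t assume "a t \<in> a ` {..<t}"
  then show "last_use a t (a t) \<le> last_use a (Suc t) (a t)"
    using last_use_mem[of "a t" a t] by (simp add: last_use_now)
qed (auto simp: last_use_other evict_lru)

text \<open>Either the misses concern pairwise different elements, or one element is missed again
  after an access within the window. In the latter case \<open>s\<close> other elements were used in
  between, which is enough because at most \<open>s\<close> misses are to be bounded.\<close>

lemma misses_le_distinct:
  assumes "m \<le> n" "n \<le> N" "misses n - misses m \<le> s"
  shows "misses n - misses m \<le> card (a ` {m..<n})"
proof -
  let ?T = "{t. m \<le> t \<and> t < n \<and> a t \<notin> C t}"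
  have "?T = {t. t < n \<and> a t \<notin> C t} - {t. t < m \<and> a t \<notin> C t}" by auto
  then have T: "card ?T = misses n - misses m"
    unfolding misses_def using assms by (simp add: card_Diff_subset subset_iff)
  show ?thesis
  proof (cases "inj_on a ?T")
    case True
    then have "card ?T = card (a ` ?T)" by (simp add: card_image)
    also have "\<dots> \<le> card (a ` {m..<n})" by (intro card_mono) auto
    finally show ?thesis using T by simp
  next
    case False
    then obtain i j where ij: "m \<le> i" "i < j" "j < n" "a j \<notin> C j" "a i = a j"
      unfolding inj_on_def by simp (metis linorder_neqE_nat)
    have i: "i \<le> last_use a j (a j)" using ij by (intro last_use_ge) auto
    have "s \<le> card {w \<in> a ` {..<j}. w \<noteq> a j \<and> last_use a j (a j) \<le> last_use a j w}"
      using ij assms by (intro not_mem_content_rank image_eqI[of _ _ i]) auto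
    also have "\<dots> \<le> card (a ` {m..<n})"
    proof (intro card_mono subsetI)
      fix w assume w: "w \<in> {w \<in> a ` {..<j}. w \<noteq> a j \<and> last_use a j (a j) \<le> last_use a j w}"
      then have "last_use a j w < j" "a (last_use a j w) = w" "i \<le> last_use a j w"
        using i last_use_mem[of w a j] by auto
      then show "w \<in> a ` {m..<n}"
        using ij by (intro image_eqI[of _ _ "last_use a j w"]) auto
    qed simp
    finally show ?thesis using assms(3) by simp
  qed
qed

text \<open>The trace is cut backwards into phases of \<open>s\<close> misses each, so that only the first phase can
  be incomplete; there the other cache starts empty.\<close>

lemma misses_le_twice:
  assumes "lazy_cache a N h ev' C'" and "s = 2 * h" and "n \<le> N"
  shows "misses n \<le> 2 * lazy_cache.misses a C' n"
proof -
  interpret C': lazy_cache a N h ev' C' by fact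
  show ?thesis
    using \<open>n \<le> N\<close>
  proof (induction n rule: less_induct)
    case (less n)
    show ?case
    proof (cases "misses n \<le> s")
      case True
      then have "misses n \<le> card (a ` {0..<n})"
        using misses_le_distinct[of 0 n] less.prems by simp
      also have "\<dots> \<le> C'.misses n"
        using C'.distinct_le_misses[of 0 n] less.prems by (simp add: C'.content_0)
      finally show ?thesis by simp
    next
      case False
      \<comment> \<open>The miss counter starts at 0 and grows by at most one per access, so it
        takes every intermediate value.\<close>
      have "\<exists>m\<le>n. misses m = misses n - s"
      proof -
        have "\<exists>m\<le>n. misses m = k" if "k \<le> misses n" for k
          using that
        proof (induction n)
          case 0
          then show ?case by simp
        next
          case (Suc n)
          then show ?case
            by (cases "k \<le> misses n") (auto simp: misses_Suc le_Suc_eq split: if_splits)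
        qed
        then show ?thesis by simp
      qed
      then obtain m where m: "m \<le> n" "misses m = misses n - s" by blast
      then have diff: "misses n - misses m = s" using False by simp
      have "m < n" using m diff s_pos by (cases "m = n") auto
      then have IH: "misses m \<le> 2 * C'.misses m" using less by simp
      have "s \<le> card (a ` {m..<n})"
        using misses_le_distinct[OF m(1) less.prems] diff by simp
      \<comment> \<open>Of the \<open>s\<close> distinct elements of the phase, the smaller cache
        can hold at most \<open>h\<close> at its start; the remaining \<open>s - h = h\<close> cost
        a miss each.\<close>
      then have "s - h \<le> card (a ` {m..<n}) - card (C' m)"
        using C'.card_content[of m] m less.prems by linarith
      also have "\<dots> \<le> card (a ` {m..<n} - C' m)"
        using C'.finite_content[of m] m less.prems by (intro diff_card_le_card_Diff) auto
      also have "\<dots> \<le> C'.misses n - C'.misses m"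
        using C'.distinct_le_misses m less.prems by simp
      finally show ?thesis
        using IH diff False C'.misses_mono[OF m(1)] \<open>s = 2 * h\<close> by simp
    qed
  qed
qed

end

subsection \<open>Translation paths\<close>

lemma nth_concat_map_uniform:
  assumes "\<And>x. length (f x) = n" and "n > 0" and "t < length xs * n"
  shows "concat (map f xs) ! t = f (xs ! (t div n)) ! (t mod n)"
  using assms(3)
proof (induction xs arbitrary: t)
  case Nil
  then show ?case by simp
next
  case (Cons x xs)
  show ?case
  proof (cases "t < n")
    case True
    then show ?thesis by (simp add: nth_append assms(1))
  next
    case False
    then have "concat (map f xs) ! (t - n) = f (xs ! ((t - n) div n)) ! ((t - n) mod n)"
      using Cons.prems by (intro Cons.IH) auto
    then show ?thesis
      using False \<open>n > 0\<close> by (simp add: nth_append assms(1) le_div_geq le_mod_geq)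
  qed
qed

lemma finite_maximizer:
  fixes f :: "'a \<Rightarrow> 'b::linorder"
  assumes "finite S" "S \<noteq> {}"
  shows "\<exists>v\<in>S. \<forall>w\<in>S. f w \<le> f v"
proof -
  have "Max (f ` S) \<in> f ` S" using assms by simp
  then obtain v where "v \<in> S" "f v = Max (f ` S)" by auto
  then show ?thesis using assms(1) by (intro bexI[of _ v]) auto
qed

lemma finite_minimizer:
  fixes f :: "'a \<Rightarrow> 'b::linorder"
  assumes "finite S" "S \<noteq> {}"
  shows "\<exists>v\<in>S. \<forall>w\<in>S. f v \<le> f w"
proof -
  have "Min (f ` S) \<in> f ` S" using assms by simp
  then obtain v where "v \<in> S" "f v = Min (f ` S)" by auto
  then show ?thesis using assms(1) by (intro bexI[of _ v]) auto
qed

text \<open>Going up one layer divides the index by \<open>K\<close>. The bound on the layer of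
  \<open>v\<close> needs \<open>v \<noteq> w\<close>, since the reflexive closure relates pairs
  outside the tree to themselves.\<close>

lemma descendant_div:
  assumes "descendant K d v w"
  shows "fst w \<le> fst v \<and> (v \<noteq> w \<longrightarrow> fst v \<le> d) \<and> snd v = snd w div K ^ (fst v - fst w)"
  using assms unfolding descendant_def
proof (induction rule: rtranclp_induct)
  case base
  then show ?case by simp
next
  case (step y w)
  from step.hyps(2) obtain l i b
    where y: "y = (Suc l, i)" "y \<in> tree_nodes K d" and b: "b < K" and w: "w = (l, K * i + b)"
    by (auto simp: child_def)
  have "Suc l \<le> d" using y by (auto simp: tree_nodes_def)
  moreover have "Suc l \<le> fst v" using step.IH y by simp
  then have "fst v - l = Suc (fst v - Suc l)" by linarith
  moreover have "(K * i + b) div K = i" using b by simp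
  ultimately show ?case using step.IH y w by (auto simp: div_mult2_eq)
qed

lemma descendant_trans: "\<lbrakk>descendant K d u v; descendant K d v w\<rbrakk> \<Longrightarrow> descendant K d u w"
  unfolding descendant_def by (rule rtranclp_trans)

lemma descendant_refl: "descendant K d v v"
  by (simp add: descendant_def)

section \<open>Existence of permitted victims\<close>

lemma min_victims_subset: "min_victims K P d as t C \<subseteq> C"
  by (auto simp: min_victims_def)

lemma min_victims_nonempty: "\<lbrakk>finite C; C \<noteq> {}\<rbrakk> \<Longrightarrow> min_victims K P d as t C \<noteq> {}"
  using finite_maximizer[of C "next_access K P d as t"] by (auto simp: min_victims_def)

lemma lru_victims_nonempty: "\<lbrakk>finite C; C \<noteq> {}\<rbrakk> \<Longrightarrow> lru_victims K P d as t C \<noteq> {}"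
  using finite_minimizer[of C "last_access K P d as t"] by (auto simp: lru_victims_def)

lemma islru_victims_nonempty:
  assumes "finite C" "C \<noteq> {}"
  shows "islru_victims K P d as t C \<noteq> {}"
proof -
  obtain v where v: "v \<in> lru_victims K P d as t C"
    using lru_victims_nonempty[OF assms] by blast
  let ?S = "{u \<in> C. descendant K d v u}"
  have "v \<in> ?S"
    using v by (simp add: lru_victims_def descendant_refl)
  then have "?S \<noteq> {}" by blast
  moreover have "finite ?S" using assms(1) by simp
  ultimately obtain w where "w \<in> ?S" "\<forall>u\<in>?S. fst w \<le> fst u"
    using finite_minimizer[of ?S fst] by blast
  then have "w \<in> islru_victims K P d as t C"
    using v unfolding islru_victims_def by blast
  then show ?thesis by blast
qed

text \<open>Take a cached descendant of \<open>w\<close> on the lowest layer: a further cached node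
  below it would also descend from \<open>w\<close>.\<close>

lemma leaf_descendant:
  assumes "finite C" "w \<in> C"
  shows "\<exists>u\<in>C. descendant K d w u \<and> (\<forall>z\<in>C. descendant K d u z \<longrightarrow> z = u)"
proof -
  let ?S = "{u \<in> C. descendant K d w u}"
  have "w \<in> ?S" using assms by (simp add: descendant_refl)
  then have "?S \<noteq> {}" by blast
  moreover have "finite ?S" using assms(1) by simp
  ultimately obtain u where u: "u \<in> C" "descendant K d w u"
    and low: "\<And>z. \<lbrakk>z \<in> C; descendant K d w z\<rbrakk> \<Longrightarrow> fst u \<le> fst z"
    using finite_minimizer[of ?S fst] by blast
  have "z = u" if "z \<in> C" "descendant K d u z" for z
    using low[OF that(1) descendant_trans[OF u(2) that(2)]] descendant_div[OF that(2)]
    by (simp add: prod_eq_iff)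
  then show ?thesis using u by blast
qed

section \<open>The access sequence in coordinates: number of the translation and layer\<close>

locale translation_trace =
  fixes K P d :: nat and as :: "nat list"
  assumes address_bound: "\<alpha> \<in> set as \<Longrightarrow> \<alpha> < K ^ d * P"
    and K_pos: "K > 0"
begin

abbreviation D :: nat where "D \<equiv> Suc d"
abbreviation acc :: "nat \<Rightarrow> node" where "acc \<equiv> (!) (accesses K P d as)"
abbreviation N :: nat where "N \<equiv> length (accesses K P d as)"

definition path_node :: "nat \<Rightarrow> nat \<Rightarrow> node" where
  "path_node \<tau> l = (l, as ! \<tau> div (P * K ^ l))"

lemma fst_path_node [simp]: "fst (path_node \<tau> l) = l"
  by (simp add: path_node_def)

lemma length_translation_path: "length (translation_path K P d \<alpha>) = D"
  by (simp add: translation_path_def)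

lemma translation_path_nth:
  "m \<le> d \<Longrightarrow> translation_path K P d \<alpha> ! m = (d - m, \<alpha> div (P * K ^ (d - m)))"
  by (simp add: translation_path_def rev_nth del: upt_Suc)

lemma length_accesses: "N = length as * D"
  by (simp add: accesses_def length_concat comp_def length_translation_path sum_list_triv)

lemma time_less: "t < N \<longleftrightarrow> t div D < length as"
  by (simp add: length_accesses div_less_iff_less_mult del: mult_Suc_right)

lemma acc_eq: "t < N \<Longrightarrow> acc t = path_node (t div D) (d - t mod D)"
  unfolding accesses_def
  using length_accesses[unfolded accesses_def]
  by (subst nth_concat_map_uniform[where n = D])
    (simp_all add: length_translation_path translation_path_nth path_node_def
      del: mult_Suc_right)

text \<open>Paths are walked from the root, so layer \<open>l\<close> is reached
  \<open>d - l\<close> accesses after the start of its translation.\<close>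

lemma acc_path_node:
  assumes "\<tau> < length as" "l \<le> d"
  shows "\<tau> * D + (d - l) < N" "acc (\<tau> * D + (d - l)) = path_node \<tau> l"
proof -
  have div: "(\<tau> * D + (d - l)) div D = \<tau>" "(\<tau> * D + (d - l)) mod D = d - l"
    by (simp_all del: mult_Suc_right)
  then show "\<tau> * D + (d - l) < N" using assms time_less by metis
  then show "acc (\<tau> * D + (d - l)) = path_node \<tau> l" using div assms by (simp add: acc_eq)
qed

lemma current_path_eq: "current_path K P d as t = path_node (t div D) ` {..d}"
  unfolding current_path_def translation_path_def path_node_def by (auto simp: image_iff)

lemma acc_in_block: "t < N \<Longrightarrow> acc t \<in> path_node (t div D) ` {..d}"
  by (simp add: acc_eq)

text \<open>Iterated floor division by \<open>K\<close> merges into one division of the address, so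
  the ancestors of a path node lie on the same path.\<close>

lemma path_node_ancestor:
  assumes "descendant K d v (path_node \<tau> l)" "l \<le> d"
  shows "v = path_node \<tau> (fst v)" "l \<le> fst v" "fst v \<le> d"
proof -
  note desc = descendant_div[OF assms(1)]
  show l: "l \<le> fst v" using desc by simp
  show "fst v \<le> d" using desc assms(2) by (cases "v = path_node \<tau> l") auto
  have "snd v = as ! \<tau> div (P * K ^ l * K ^ (fst v - l))"
    using desc by (simp add: path_node_def div_mult2_eq)
  also have "P * K ^ l * K ^ (fst v - l) = P * K ^ fst v"
    using l by (simp flip: power_add)
  finally show "v = path_node \<tau> (fst v)" by (simp add: path_node_def prod_eq_iff)
qed

lemma path_node_descendant:
  assumes "\<tau> < length as" "l \<le> m" "m \<le> d"
  shows "descendant K d (path_node \<tau> m) (path_node \<tau> l)"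
  using assms(2,3)
proof (induction m rule: dec_induct)
  case base
  then show ?case by (simp add: descendant_refl)
next
  case (step m)
  let ?\<alpha> = "as ! \<tau>"
  \<comment> \<open>\<open>child\<close> demands that the parent is a node of the tree; the address
    bound provides this.\<close>
  have "?\<alpha> < K ^ d * P" using assms(1) by (intro address_bound) simp
  also have "K ^ d = K ^ (d - Suc m) * K ^ Suc m"
    using step.prems by (simp flip: power_add power_Suc)
  finally have "?\<alpha> div (P * K ^ Suc m) < K ^ (d - Suc m)"
    by (intro less_mult_imp_div_less) (simp add: ac_simps)
  then have "path_node \<tau> (Suc m) \<in> tree_nodes K d"
    using step.prems by (simp add: tree_nodes_def path_node_def)
  moreover have "?\<alpha> div (P * K ^ Suc m) = ?\<alpha> div (P * K ^ m) div K"
    by (simp add: ac_simps flip: div_mult2_eq)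
  \<comment> \<open>Division with remainder: the remainder modulo \<open>K\<close> is the number of
    the child.\<close>
  then have "path_node \<tau> m = (m, K * (?\<alpha> div (P * K ^ Suc m)) + ?\<alpha> div (P * K ^ m) mod K)"
    by (simp add: path_node_def)
  moreover have "?\<alpha> div (P * K ^ m) mod K < K" using K_pos by simp
  ultimately have "child K d (path_node \<tau> (Suc m)) (path_node \<tau> m)"
    unfolding child_def by (auto simp: path_node_def)
  then show ?case
    using step unfolding descendant_def by (auto intro: converse_rtranclp_into_rtranclp)
qed

lemma next_access_eq: "next_access K P d as = next_use acc N"
  by (simp add: fun_eq_iff next_access_def next_use_def)

lemma last_access_eq: "t \<le> N \<Longrightarrow> last_access K P d as t = last_use acc t"
  unfolding fun_eq_iff last_access_def last_use_def
  by (intro allI arg_cong[where f = Max]) auto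

text \<open>\<open>evicts_from\<close> says nothing where no node is permitted, so permitted victims
  must exist at each miss of a full cache within the trace.\<close>

lemma lazy_cache_tc_content:
  assumes "evicts_from A V" "s > 0"
    and nonempty: "\<And>t C. \<lbrakk>t < N; acc t \<notin> C; finite C; card C = s\<rbrakk> \<Longrightarrow> V as t C \<noteq> {}"
    and subset: "\<And>t C. V as t C \<subseteq> C"
  shows "lazy_cache acc N s (\<lambda>t. A as t (tc_content K P d A s as t)) (tc_content K P d A s as)"
proof
  fix t assume t: "t < N" "acc t \<notin> tc_content K P d A s as t" "card (tc_content K P d A s as t) = s"
  then have "finite (tc_content K P d A s as t)" using \<open>s > 0\<close> by (metis card.infinite less_numeral_extra(3))
  then have "V as t (tc_content K P d A s as t) \<noteq> {}" using nonempty t by blast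
  then show "A as t (tc_content K P d A s as t) \<in> tc_content K P d A s as t"
    using assms(1) subset unfolding evicts_from_def by blast
qed (use \<open>s > 0\<close> in \<open>simp_all add: Let_def\<close>)

lemma insertions_eq_misses:
  assumes "lazy_cache acc N s ev (tc_content K P d A s as)"
  shows "insertions K P d A s as = lazy_cache.misses acc (tc_content K P d A s as) N"
  by (simp add: insertions_def lazy_cache.misses_def[OF assms])

subsection \<open>The four strategies\<close>

lemma lazy_cache_MIN:
  assumes "is_MIN K P d A" "s > 0"
  shows "lazy_cache acc N s (\<lambda>t. A as t (tc_content K P d A s as t)) (tc_content K P d A s as)"
proof (rule lazy_cache_tc_content)
  show "evicts_from A (min_victims K P d)" using assms(1) by (simp add: is_MIN_def)
  show "min_victims K P d as t C \<subseteq> C" for t C by (rule min_victims_subset)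
  show "min_victims K P d as t C \<noteq> {}" if "finite C" "card C = s" for t C
    using min_victims_nonempty that assms(2) by fastforce
qed fact

lemma MIN_optimal:
  assumes "is_MIN K P d A" "s > 0" and "lazy_cache acc N s ev C"
  shows "insertions K P d A s as \<le> lazy_cache.misses acc C N"
proof -
  let ?M = "tc_content K P d A s as"
  interpret M: lazy_cache acc N s "\<lambda>t. A as t (?M t)" ?M
    using assms by (intro lazy_cache_MIN)
  have "M.misses N \<le> lazy_cache.misses acc C N"
  proof (rule furthest_next_optimal[OF M.lazy_cache_axioms assms(3), where Q = "\<lambda>_. {}"])
    fix t v assume t: "t < N" and full: "card (?M t) = s" and v: "v \<in> ?M t - {}"
    have "A as t (?M t) \<in> min_victims K P d as t (?M t)"
      using assms(1) min_victims_nonempty M.finite_content[of t] t v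
      unfolding is_MIN_def evicts_from_def by fastforce
    then show "next_use acc N t v \<le> next_use acc N t (A as t (?M t))"
      using v by (simp add: min_victims_def next_access_eq)
  qed auto
  then show ?thesis by (simp add: insertions_eq_misses[OF M.lazy_cache_axioms])
qed

section \<open>ISMIN against caches that keep the part of the current path already accessed\<close>

definition served :: "nat \<Rightarrow> node set" where
  "served t = acc ` {i. i < t \<and> i div D = t div D}"

lemma served_current_path: "t < N \<Longrightarrow> served t \<subseteq> path_node (t div D) ` {..d}"
  unfolding served_def using acc_in_block by (smt (verit) image_subsetI mem_Collect_eq order.strict_trans)

text \<open>A served node entered or was present when accessed in this translation, and evictions
  spare it until the translation ends. These nodes are the protected set of the Belady argument for
  ISMIN.\<close>

lemma served_in_content:
  assumes "lazy_cache acc N s ev C"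
    and "\<And>t. \<lbrakk>t < N; acc t \<notin> C t; card (C t) = s\<rbrakk> \<Longrightarrow> ev t \<notin> served t"
  shows "t \<le> N \<Longrightarrow> served t \<subseteq> C t"
proof (induction t)
  case 0
  then show ?case by (simp add: served_def)
next
  case (Suc t)
  interpret lazy_cache acc N s ev C by fact
  have t: "t < N" using Suc.prems by simp
  show ?case
  proof
    fix v assume "v \<in> served (Suc t)"
    then obtain i where i: "i < Suc t" "i div D = Suc t div D" "v = acc i"
      unfolding served_def by auto
    show "v \<in> C (Suc t)"
    proof (cases "i = t")
      case True
      then show ?thesis using i accessed_mem[OF t] by simp
    next
      case False
      then have "i < t" using i by simp
      moreover have "i div D = t div D"
        using i \<open>i < t\<close> by (metis div_le_mono le_antisym lessI less_imp_le)
      ultimately have v: "v \<in> served t" using i unfolding served_def by auto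
      then have "v \<in> C t" using Suc by auto
      then show ?thesis
        using t
        by (cases rule: content_cases[OF t]) (use assms(2)[OF t] v in auto)
    qed
  qed
qed

text \<open>A translation using \<open>u\<close> uses its ancestor \<open>w\<close> first. As
  \<open>w\<close> is off the current path, that translation is a later one, so this use of
  \<open>w\<close> is not already past.\<close>

lemma next_use_descendant:
  assumes "descendant K d w u" "w \<notin> path_node (t div D) ` {..d}"
  shows "next_use acc N t w \<le> next_use acc N t u"
proof (cases "next_use acc N t u")
  case (enat i)
  from next_use_attained[OF this] have i: "t \<le> i" "i < N" "acc i = u" by auto
  let ?\<tau> = "i div D" and ?j = "i div D * D + (d - fst w)"
  have desc: "descendant K d w (path_node ?\<tau> (d - i mod D))"
    using assms(1) i acc_eq by simp
  note w = path_node_ancestor[OF desc diff_le_self]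
  have "?\<tau> \<noteq> t div D" using w assms(2) by (metis atMost_iff imageI)
  then have "t div D < ?\<tau>" using div_le_mono[OF i(1), of D] by simp
  then have "t \<le> ?j" using dividend_less_times_div[of D t]
    by (metis div_less_iff_less_mult less_imp_le trans_le_add1 zero_less_Suc)
  moreover have "?j < N" "acc ?j = w"
    using acc_path_node[of ?\<tau> "fst w"] w i(2) time_less by auto
  ultimately have "next_use acc N t w \<le> enat ?j" by (intro next_use_le)
  also have "?j \<le> i"
  proof -
    have "d - fst w \<le> i mod D" using w(2) by simp
    then show ?thesis using div_mult_mod_eq[of i D] by linarith
  qed
  finally show ?thesis using enat by simp
qed simp

text \<open>A cached leaf below \<open>w\<close> is off the current path, because all ancestors of
  path nodes are on the path.\<close>

lemma ismin_candidate_below: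
  assumes "finite C" "w \<in> C" "w \<notin> path_node (t div D) ` {..d}"
  shows "\<exists>u\<in>ismin_candidates K P d as t C. descendant K d w u"
proof -
  obtain u where u: "u \<in> C" "descendant K d w u" "\<forall>z\<in>C. descendant K d u z \<longrightarrow> z = u"
    using leaf_descendant[OF assms(1,2)] by blast
  have "u \<notin> path_node (t div D) ` {..d}"
  proof
    assume "u \<in> path_node (t div D) ` {..d}"
    then obtain l where l: "l \<le> d" "u = path_node (t div D) l" by auto
    then have "descendant K d w (path_node (t div D) l)" using u(2) by simp
    from path_node_ancestor[OF this l(1)] show False using assms(3) by blast
  qed
  then show ?thesis using u unfolding ismin_candidates_def current_path_eq by blast
qed

lemma ismin_candidates_nonempty:
  assumes "t < N" "acc t \<notin> C" "finite C" "d < card C"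
  shows "ismin_candidates K P d as t C \<noteq> {}"
proof -
  let ?B = "path_node (t div D) ` {..d}"
  have "\<not> C \<subseteq> ?B"
  proof
    assume "C \<subseteq> ?B"
    then have "insert (acc t) C \<subseteq> ?B" using acc_in_block[OF assms(1)] by simp
    \<comment> \<open>The missing node and more than \<open>d\<close> cached ones would be at least
      \<open>d + 2\<close> nodes on a path of \<open>d + 1\<close>.\<close>
    then have "card (insert (acc t) C) \<le> card ?B" by (intro card_mono) auto
    also have "\<dots> \<le> D" using card_image_le[of "{..d}"] by fastforce
    finally show False using assms by simp
  qed
  then show ?thesis using ismin_candidate_below[OF assms(3)] by blast
qed

lemma ismin_victims_subset: "ismin_victims K P d as t C \<subseteq> ismin_candidates K P d as t C"
  unfolding ismin_victims_def by (rule min_victims_subset)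

lemma ismin_candidates_subset: "ismin_candidates K P d as t C \<subseteq> C"
  unfolding ismin_candidates_def by blast

lemma ismin_victims_nonempty:
  assumes "t < N" "acc t \<notin> C" "finite C" "d < card C"
  shows "ismin_victims K P d as t C \<noteq> {}"
  unfolding ismin_victims_def
  using ismin_candidates_nonempty[OF assms] finite_subset[OF ismin_candidates_subset assms(3)]
  by (intro min_victims_nonempty)

lemma lazy_cache_ISMIN:
  assumes "is_ISMIN K P d A" "d < s"
  shows "lazy_cache acc N s (\<lambda>t. A as t (tc_content K P d A s as t)) (tc_content K P d A s as)"
proof (rule lazy_cache_tc_content)
  show "evicts_from A (ismin_victims K P d)" using assms(1) by (simp add: is_ISMIN_def)
  show "ismin_victims K P d as t C \<subseteq> C" for t C
    using ismin_victims_subset ismin_candidates_subset by blast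
qed (use assms(2) ismin_victims_nonempty in auto)

text \<open>Every cached node off the current path is needed no later than some cached leaf below it, so
  the eviction of ISMIN is the furthest one among all nodes outside \<open>served t\<close>.\<close>

lemma ISMIN_optimal:
  assumes "is_ISMIN K P d A" "d < s" and "lazy_cache acc N s ev C"
    and "\<And>t. t < N \<Longrightarrow> served t \<subseteq> C (Suc t)"
  shows "insertions K P d A s as \<le> lazy_cache.misses acc C N"
proof -
  let ?M = "tc_content K P d A s as"
  interpret M: lazy_cache acc N s "\<lambda>t. A as t (?M t)" ?M
    using assms by (intro lazy_cache_ISMIN)
  have victim: "A as t (?M t) \<in> ismin_victims K P d as t (?M t)"
    if "t < N" "acc t \<notin> ?M t" "card (?M t) = s" for t
    using assms(1,2) ismin_victims_nonempty[of t "?M t"] M.finite_content[of t] that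
    unfolding is_ISMIN_def evicts_from_def by simp
  have off_path: "A as t (?M t) \<notin> path_node (t div D) ` {..d}"
    if "t < N" "acc t \<notin> ?M t" "card (?M t) = s" for t
    using victim[OF that] ismin_victims_subset
    by (auto simp: ismin_candidates_def current_path_eq)
  have unserved: "A as t (?M t) \<notin> served t"
    if "t < N" "acc t \<notin> ?M t" "card (?M t) = s" for t
    using off_path[OF that] served_current_path[OF that(1)] by blast
  have "M.misses N \<le> lazy_cache.misses acc C N"
  proof (rule furthest_next_optimal[OF M.lazy_cache_axioms assms(3), where Q = served])
    fix t v assume t: "t < N" and miss: "acc t \<notin> ?M t" "card (?M t) = s"
      and v: "v \<in> ?M t - served t"
    let ?y = "A as t (?M t)"
    show "next_use acc N t v \<le> next_use acc N t ?y"
    proof (cases "v \<in> path_node (t div D) ` {..d}")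
      case False
      then obtain u where "u \<in> ismin_candidates K P d as t (?M t)" "descendant K d v u"
        using ismin_candidate_below[of "?M t" v t] M.finite_content[of t] t v by auto
      then show ?thesis
        using next_use_descendant[OF _ False, of u] victim[OF t miss]
        unfolding ismin_victims_def min_victims_def next_access_eq by (blast intro: order_trans)
    next
      case True
      \<comment> \<open>A node of the current path that is not yet served is still due in this
        translation, at time \<open>?j\<close>.\<close>
      then obtain l where l: "l \<le> d" "v = path_node (t div D) l" by auto
      let ?j = "t div D * D + (d - l)"
      have j: "?j < N" "acc ?j = v"
        using acc_path_node[of "t div D" l] l t time_less by auto
      have jD: "?j div D = t div D" by (simp del: mult_Suc_right)
      have "v \<in> served t" if "?j < t"
        unfolding served_def using that j(2) jD by blast
      then have tj: "t \<le> ?j" using v by (meson DiffD2 not_less)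
      show ?thesis
      proof (cases "next_use acc N t ?y")
        case (enat i)
        from next_use_attained[OF this] have i: "t \<le> i" "i < N" "acc i = ?y" by auto
        \<comment> \<open>A use of the victim before \<open>?j\<close> would belong to the current
          translation, whose path avoids the victim.\<close>
        have "?j \<le> i"
        proof (rule ccontr)
          assume "\<not> ?j \<le> i"
          then have "i div D = t div D"
            using i(1) jD by (metis div_le_mono le_antisym nat_le_linear)
          then show False using off_path[OF t miss] acc_in_block[OF i(2)] i(3) by simp
        qed
        have "next_use acc N t v \<le> enat ?j" by (rule next_use_le) (use tj j in simp_all)
        also have "enat ?j \<le> enat i" using \<open>?j \<le> i\<close> by simp
        finally show ?thesis using enat by simp
      qed simp
    qed
  next
    fix t assume "t < N"
    then have "t \<le> N" by simp
    then show "served t \<subseteq> ?M t"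
      by (rule served_in_content[OF M.lazy_cache_axioms, rotated]) (fact unserved)
  qed (fact assms(4), fact unserved)
  then show ?thesis by (simp add: insertions_eq_misses[OF M.lazy_cache_axioms])
qed

section \<open>LRU and ISLRU as keyed caches\<close>

lemma lru_cache_LRU:
  assumes "is_LRU K P d A" "s > 0"
  shows "lru_cache acc N s (\<lambda>t. A as t (tc_content K P d A s as t)) (tc_content K P d A s as)"
proof -
  let ?C = "tc_content K P d A s as"
  interpret lazy_cache acc N s "\<lambda>t. A as t (?C t)" ?C
  proof (rule lazy_cache_tc_content)
    show "evicts_from A (lru_victims K P d)" using assms(1) by (simp add: is_LRU_def)
    show "lru_victims K P d as t C \<subseteq> C" for t C by (auto simp: lru_victims_def)
    show "lru_victims K P d as t C \<noteq> {}" if "finite C" "card C = s" for t C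
      using lru_victims_nonempty that assms(2) by fastforce
  qed fact
  show ?thesis
  proof
    fix t v assume t: "t < N" and v: "v \<in> ?C t"
    have "A as t (?C t) \<in> lru_victims K P d as t (?C t)"
      using assms(1) lru_victims_nonempty finite_content[of t] t v
      unfolding is_LRU_def evicts_from_def by fastforce
    then show "last_use acc t (A as t (?C t)) \<le> last_use acc t v"
      using v t by (simp add: lru_victims_def last_access_eq)
  qed
qed

text \<open>The lexicographic order by translation of last use, then layer, packed into one number
  since layers are below \<open>D\<close>. Within a translation it reverses the order of
  \<open>last_use\<close>: nodes near the root rank highest.\<close>

definition block_key :: "nat \<Rightarrow> node \<Rightarrow> nat" where
  "block_key t v = last_use acc t v div D * D + fst v"

lemma last_use_path_node:
  assumes "t \<le> N" "v \<in> acc ` {..<t}"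
  shows "v = path_node (last_use acc t v div D) (fst v)" "fst v = d - last_use acc t v mod D"
    "fst v \<le> d" "last_use acc t v < t" "last_use acc t v div D < length as"
proof -
  let ?i = "last_use acc t v"
  have i: "?i < t" "acc ?i = v" using last_use_mem[OF assms(2)] by auto
  then have v: "v = path_node (?i div D) (d - ?i mod D)" using acc_eq[of ?i] assms(1) by simp
  then show fst: "fst v = d - ?i mod D" by (metis fst_path_node)
  then show "v = path_node (?i div D) (fst v)" using v by simp
  show "fst v \<le> d" using fst by simp
  show "?i < t" by fact
  show "?i div D < length as" using i(1) assms(1) time_less[of ?i] by simp
qed

lemma block_key_less:
  assumes "fst v \<le> d" "last_use acc t v div D < \<tau>"
  shows "block_key t v < \<tau> * D"
proof -
  have "block_key t v < Suc (last_use acc t v div D) * D"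
    using assms(1) by (simp add: block_key_def)
  also have "\<dots> \<le> \<tau> * D" using assms(2) by (intro mult_le_mono1) simp
  finally show ?thesis .
qed

text \<open>Up to the end of translation \<open>\<tau>\<close>, such keys belong to nodes last used
  in \<open>\<tau>\<close> itself. These lie on a single path of \<open>d + 1\<close> nodes, and
  \<open>w\<close> is one of them.\<close>

lemma card_block:
  assumes "w \<in> path_node \<tau> ` {..d}" "t \<le> N" "t \<le> Suc \<tau> * D"
  shows "card {v \<in> acc ` {..<t}. v \<noteq> w \<and> \<tau> * D \<le> block_key t v} \<le> d"
proof -
  have "{v \<in> acc ` {..<t}. v \<noteq> w \<and> \<tau> * D \<le> block_key t v} \<subseteq> path_node \<tau> ` {..d} - {w}"
  proof
    fix v assume v: "v \<in> {v \<in> acc ` {..<t}. v \<noteq> w \<and> \<tau> * D \<le> block_key t v}"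
    then have mem: "v \<in> acc ` {..<t}" by simp
    note lu = last_use_path_node[OF assms(2) mem]
    have "last_use acc t v < Suc \<tau> * D" using lu(4) assms(3) by simp
    then have "last_use acc t v div D < Suc \<tau>" by (rule less_mult_imp_div_less)
    moreover have "\<not> last_use acc t v div D < \<tau>"
      using block_key_less[OF lu(3)] v by (auto simp: not_less[symmetric])
    ultimately have "last_use acc t v div D = \<tau>" by simp
    then show "v \<in> path_node \<tau> ` {..d} - {w}" using lu(1,3) v by auto
  qed
  then have "card {v \<in> acc ` {..<t}. v \<noteq> w \<and> \<tau> * D \<le> block_key t v}
      \<le> card (path_node \<tau> ` {..d} - {w})"
    by (intro card_mono) auto
  also have "\<dots> \<le> d"
    using assms(1) card_image_le[of "{..d}" "path_node \<tau>"] by (simp add: card_Diff_singleton)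
  finally show ?thesis .
qed

text \<open>The last translation using \<open>w\<close> also used its ancestor \<open>v\<close>, the
  least recently used node, so \<open>w\<close> is no newer than any cached \<open>w'\<close> in
  terms of translations. If \<open>w'\<close> ties with \<open>w\<close>, it was used in the same
  translation as \<open>v\<close> and not before \<open>v\<close>; hence it descends from
  \<open>v\<close> and is no lower than \<open>w\<close>.\<close>

lemma islru_victim_min_key:
  assumes t: "t \<le> N" and C: "C \<subseteq> acc ` {..<t}"
    and w: "w \<in> islru_victims K P d as t C" and w': "w' \<in> C"
  shows "block_key t w \<le> block_key t w'"
proof -
  let ?L = "last_use acc t"
  obtain v where v: "v \<in> C" "\<And>u. u \<in> C \<Longrightarrow> ?L v \<le> ?L u" and vw: "descendant K d v w"
    and low: "\<And>u. \<lbrakk>u \<in> C; descendant K d v u\<rbrakk> \<Longrightarrow> fst w \<le> fst u" and "w \<in> C"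
    using w last_access_eq[OF t] by (auto simp: islru_victims_def lru_victims_def)
  let ?\<tau> = "?L w div D"
  have wS: "w \<in> acc ` {..<t}" and w'S: "w' \<in> acc ` {..<t}" and vS: "v \<in> acc ` {..<t}"
    using C \<open>w \<in> C\<close> w' v by auto
  note Lw = last_use_path_node[OF t wS] and Lw' = last_use_path_node[OF t w'S]
    and Lv = last_use_path_node[OF t vS]
  have anc: "v = path_node ?\<tau> (fst v)" "fst w \<le> fst v" "fst v \<le> d"
    using path_node_ancestor[of v ?\<tau> "fst w"] vw Lw by auto
  let ?j = "?\<tau> * D + (d - fst v)"
  have "acc ?j = v" using acc_path_node(2)[OF Lw(5) anc(3)] anc(1) by simp
  moreover have "?j \<le> ?L w"
  proof -
    have "d - fst v \<le> ?L w mod D" using anc(2) Lw(2) by linarith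
    then show ?thesis using div_mult_mod_eq[of "?L w" D] by linarith
  qed
  ultimately have "?j \<le> ?L v" using Lw(4) by (intro last_use_ge) auto
  then have "?j div D \<le> ?L v div D" by (rule div_le_mono)
  moreover have "?j div D = ?\<tau>" by (simp del: mult_Suc_right)
  ultimately have \<tau>v: "?\<tau> \<le> ?L v div D" by simp
  have vw': "?L v div D \<le> ?L w' div D" using v(2)[OF w'] by (rule div_le_mono)
  show ?thesis
  proof (cases "?\<tau> = ?L w' div D")
    case False
    then have "block_key t w < ?L w' div D * D"
      using \<tau>v vw' Lw(3) by (intro block_key_less) auto
    then show ?thesis by (simp add: block_key_def)
  next
    case True
    then have eq: "?L v div D = ?L w' div D" using \<tau>v vw' by simp
    have "?L v mod D \<le> ?L w' mod D"
      using v(2)[OF w'] eq div_mult_mod_eq[of "?L v" D] div_mult_mod_eq[of "?L w'" D] by simp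
    then have "fst w' \<le> fst v" using Lv(2) Lw'(2) by simp
    then have "descendant K d v w'"
      using path_node_descendant[OF Lv(5), of "fst w'" "fst v"] Lv(1,3) Lw'(1) eq by simp
    then have "fst w \<le> fst w'" using low w' by blast
    then show ?thesis using True by (simp add: block_key_def)
  qed
qed

lemma keyed_cache_ISLRU:
  assumes "is_ISLRU K P d A" "d < s"
  shows "keyed_cache acc N s (\<lambda>t. A as t (tc_content K P d A s as t)) (tc_content K P d A s as)
    block_key"
proof -
  let ?C = "tc_content K P d A s as"
  interpret lazy_cache acc N s "\<lambda>t. A as t (?C t)" ?C
  proof (rule lazy_cache_tc_content)
    show "evicts_from A (islru_victims K P d)" using assms(1) by (simp add: is_ISLRU_def)
    show "islru_victims K P d as t C \<subseteq> C" for t C by (auto simp: islru_victims_def)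
    show "islru_victims K P d as t C \<noteq> {}" if "finite C" "card C = s" for t C
      using islru_victims_nonempty that assms(2) by fastforce
  qed (use assms(2) in simp)
  show ?thesis
  proof
    fix t v assume t: "t < N" and v: "v \<in> ?C t"
    have "A as t (?C t) \<in> islru_victims K P d as t (?C t)"
      using assms(1) islru_victims_nonempty finite_content[of t] t v
      unfolding is_ISLRU_def evicts_from_def by fastforce
    then show "block_key t (A as t (?C t)) \<le> block_key t v"
      using islru_victim_min_key content_accessed[of t] t v by auto
  next
    fix t assume t: "t < N" "acc t \<in> acc ` {..<t}"
    then show "block_key t (acc t) \<le> block_key (Suc t) (acc t)"
      using last_use_mem[OF t(2)]
      by (simp add: block_key_def last_use_now div_le_mono del: mult_Suc_right)
  next
    fix t assume t: "t < N"
    \<comment> \<open>The new key of \<open>acc t\<close> falls into the current translation, where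
      at most \<open>d\<close> other nodes of the path can compete.\<close>
    let ?B = "{w \<in> acc ` {..<t}. w \<noteq> acc t \<and> t div D * D \<le> block_key t w}"
    have "t \<le> Suc (t div D) * D"
      using dividend_less_div_times[of D t] by simp
    then have "card ?B \<le> d"
      using card_block[OF acc_in_block[OF t]] t by simp
    moreover have "card {w \<in> acc ` {..<t}. w \<noteq> acc t \<and> block_key (Suc t) (acc t) \<le> block_key t w}
        \<le> card ?B"
      by (intro card_mono) (auto simp: block_key_def last_use_now)
    ultimately show "card {w \<in> acc ` {..<t}. w \<noteq> acc t \<and> block_key (Suc t) (acc t) \<le> block_key t w} < s"
      using assms(2) by simp
  qed (auto simp: block_key_def last_use_other)
qed

text \<open>The key of a served node lies in the current translation, so at most
  \<open>d < s\<close> nodes rank at or above it, too few to displace it.\<close>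

lemma served_ISLRU:
  assumes "keyed_cache acc N s ev C block_key" "d < s" "t < N"
  shows "served t \<subseteq> C (Suc t)"
proof (rule ccontr)
  interpret keyed_cache acc N s ev C block_key by fact
  assume "\<not> served t \<subseteq> C (Suc t)"
  then obtain i where i: "i < t" "i div D = t div D" "acc i \<notin> C (Suc t)"
    unfolding served_def by blast
  let ?w = "acc i"
  have w: "?w \<in> acc ` {..<Suc t}" using i by auto
  have "i \<le> last_use acc (Suc t) ?w" using i by (intro last_use_ge) auto
  then have "t div D * D \<le> block_key (Suc t) ?w"
    using div_le_mono[of i "last_use acc (Suc t) ?w" D] i(2)
    by (simp add: block_key_def trans_le_add1 del: mult_Suc_right)
  then have "card {v \<in> acc ` {..<Suc t}. v \<noteq> ?w \<and> block_key (Suc t) ?w \<le> block_key (Suc t) v}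
      \<le> card {v \<in> acc ` {..<Suc t}. v \<noteq> ?w \<and> t div D * D \<le> block_key (Suc t) v}"
    by (intro card_mono) auto
  also have "\<dots> \<le> d"
  proof (rule card_block)
    show "?w \<in> path_node (t div D) ` {..d}"
      using acc_in_block[of i] i assms(3) by simp
    show "Suc t \<le> N" using assms(3) by simp
    show "Suc t \<le> Suc (t div D) * D"
      using dividend_less_div_times[of D t] by simp
  qed
  finally show False
    using not_mem_content_rank[OF _ w i(3)] assms(2,3) by simp
qed

text \<open>The nodes ranked above \<open>u\<close> by ISLRU but accessed before it would be ancestors of \<open>u\<close>; these
  have just been accessed again.\<close>

lemma LRU_hit_imp_ISLRU_hit:
  assumes "keyed_cache acc N s ev C block_key" and "lru_cache acc N s ev' C'"
    and t: "t < N" and hit: "acc t \<in> C' t"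
  shows "acc t \<in> C t"
proof (rule ccontr)
  interpret I: keyed_cache acc N s ev C block_key by fact
  interpret L: lru_cache acc N s ev' C' by fact
  let ?u = "acc t" and ?T = "t div D" and ?L = "last_use acc t"
  assume miss: "?u \<notin> C t"
  have tN: "t \<le> N" using t by simp
  have u: "?u \<in> acc ` {..<t}" using L.content_accessed[OF tN] hit by blast
  note Lu = last_use_path_node[OF tN u]
  have uT: "?u = path_node ?T (d - t mod D)" using acc_eq t by simp
  \<comment> \<open>Each translation visits a layer once, so an earlier use of \<open>?u\<close>
    belongs to an earlier translation.\<close>
  have "?L ?u div D \<noteq> ?T"
  proof
    assume eq: "?L ?u div D = ?T"
    have "d - ?L ?u mod D = d - t mod D" using Lu(2) uT by (metis fst_path_node)
    moreover have "?L ?u mod D \<le> d" "t mod D \<le> d"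
      using mod_less_divisor[of D] by (simp_all add: less_Suc_eq_le[symmetric])
    ultimately have "?L ?u mod D = t mod D" by linarith
    then show False using eq Lu(4) div_mult_mod_eq[of "?L ?u" D] div_mult_mod_eq[of t D] by simp
  qed
  then have Lu_old: "?L ?u div D < ?T"
    using div_le_mono[of "?L ?u" t D] Lu(4) by simp
  \<comment> \<open>This inclusion bounds the rank in ISLRU by the rank in LRU, which is less than
    \<open>s\<close> on a hit.\<close>
  have "{w \<in> acc ` {..<t}. w \<noteq> ?u \<and> block_key t ?u \<le> block_key t w}
      \<subseteq> {w \<in> acc ` {..<t}. ?L ?u < ?L w}"
  proof
    fix w assume "w \<in> {w \<in> acc ` {..<t}. w \<noteq> ?u \<and> block_key t ?u \<le> block_key t w}"
    then have w: "w \<in> acc ` {..<t}" "w \<noteq> ?u" "block_key t ?u \<le> block_key t w" by auto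
    note Lw = last_use_path_node[OF tN w(1)]
    have "\<not> ?L w div D < ?L ?u div D"
      using block_key_less[OF Lw(3), of t "?L ?u div D"] w(3) by (auto simp: block_key_def)
    moreover have "?L w div D \<noteq> ?L ?u div D"
    proof
      assume eq: "?L w div D = ?L ?u div D"
      then have "fst ?u \<le> fst w" using w(3) by (simp add: block_key_def)
      moreover have "fst ?u \<noteq> fst w" using w(2) eq Lw(1) Lu(1) by metis
      ultimately have less: "fst ?u < fst w" by simp
      then have "descendant K d w ?u"
        using path_node_descendant[OF Lu(5), of "fst ?u" "fst w"] Lw(1,3) Lu(1) eq by simp
      then have "descendant K d w (path_node ?T (d - t mod D))" by (simp only: uT)
      then have wT: "w = path_node ?T (fst w)" by (rule path_node_ancestor(1)) simp
      \<comment> \<open>\<open>w\<close> is above \<open>?u\<close> on the current path and was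
        accessed at \<open>?j\<close> in this translation, so its last use cannot lie in the older
        one.\<close>
      let ?j = "?T * D + (d - fst w)"
      have "fst ?u = d - t mod D" using uT by (metis fst_path_node)
      then have "d - fst w < t mod D" using less Lw(3) by linarith
      then have "?j < t" using div_mult_mod_eq[of t D] by linarith
      moreover have "acc ?j = w"
        using acc_path_node(2)[of ?T "fst w"] Lw(3) wT t time_less by simp
      ultimately have "?j \<le> ?L w" by (rule last_use_ge)
      then have "?j div D \<le> ?L w div D" by (rule div_le_mono)
      then show False using eq Lu_old by (simp del: mult_Suc_right)
    qed
    ultimately have "?L ?u div D < ?L w div D" by simp
    then have "?L ?u < ?L w" using div_le_mono[of "?L w" "?L ?u" D] by linarith
    then show "w \<in> {w \<in> acc ` {..<t}. ?L ?u < ?L w}" using w by simp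
  qed
  then have "card {w \<in> acc ` {..<t}. w \<noteq> ?u \<and> block_key t ?u \<le> block_key t w}
      \<le> card {w \<in> acc ` {..<t}. ?L ?u < ?L w}"
    by (intro card_mono) auto
  then show False
    using I.not_mem_content_rank[OF tN u miss] L.mem_content_rank[OF tN hit] by simp
qed

end

theorem theorem5p15:
  fixes K P d W :: nat
    and mn ismn islru lru :: lazy_strategy
    and as :: "nat list"
  assumes "K \<ge> 2" and "P \<ge> 1" and "d \<ge> 1"
    and "W > 0" and "even W" and "W div 2 > d"
    and "\<forall>\<alpha>\<in>set as. \<alpha> < K ^ d * P"
    and "is_MIN K P d mn" and "is_ISMIN K P d ismn"
    and "is_ISLRU K P d islru" and "is_LRU K P d lru"
  shows "insertions K P d mn W as \<le> insertions K P d ismn W as \<and>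
         insertions K P d ismn W as \<le> insertions K P d islru W as \<and>
         insertions K P d islru W as \<le> insertions K P d lru W as \<and>
         insertions K P d lru W as \<le> 2 * insertions K P d mn (W div 2) as"
proof -
  interpret translation_trace K P d as
    using assms(1,7) by unfold_locales auto
  define h where "h = W div 2"
  have h: "h > 0" "W = 2 * h" "d < W" using assms(5,6) by (auto simp: h_def)
  note cMIN = lazy_cache_MIN[OF assms(8) h(1)]
  note cISMIN = lazy_cache_ISMIN[OF assms(9) h(3)]
  note kISLRU = keyed_cache_ISLRU[OF assms(10) h(3)]
  note cISLRU = keyed_cache.axioms(1)[OF kISLRU]
  note lLRU = lru_cache_LRU[OF assms(11) assms(4)]
  note cLRU = lru_cache.axioms(1)[OF lLRU]
  have "insertions K P d mn W as \<le> insertions K P d ismn W as"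
    using MIN_optimal[OF assms(8,4) cISMIN] by (simp add: insertions_eq_misses[OF cISMIN])
  moreover have "insertions K P d ismn W as \<le> insertions K P d islru W as"
    using ISMIN_optimal[OF assms(9) h(3) cISLRU served_ISLRU[OF kISLRU h(3)]]
    by (simp add: insertions_eq_misses[OF cISLRU])
  \<comment> \<open>The comparison is access by access: the times of misses of ISLRU are among those
    of LRU.\<close>
  moreover have "insertions K P d islru W as \<le> insertions K P d lru W as"
    unfolding insertions_def using LRU_hit_imp_ISLRU_hit[OF kISLRU lLRU]
    by (intro card_mono) auto
  moreover have "insertions K P d lru W as \<le> 2 * insertions K P d mn h as"
    using lru_cache.misses_le_twice[OF lLRU cMIN h(2) order_refl]
    by (simp add: insertions_eq_misses[OF cLRU] insertions_eq_misses[OF cMIN])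
  ultimately show ?thesis by (simp add: h_def)
qed

end
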